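(* Let $G$ be a discrete group, $H$ a subgroup of $G$, and $\mathcal{A}=\bigoplus_{g\in G}\mathcal{A}_g$ a unital $G$-graded $*$-algebra. Let $p_H$ be the canonical projection of $\mathcal{A}$ onto $\mathcal{A}_H=\bigoplus_{h\in H}\mathcal{A}_h$, that is, $p_H(a)=\sum_{g\in H}a_g$ for $a=\sum_{g\in G}a_g$, where $a_g\in\mathcal{A}_g$. Then $p_H$ is a conditional expectation of $\mathcal{A}$ onto $\mathcal{A}_H$.
   Context: A $*$-algebra is a complex associative algebra with involution. A $G$-graded $*$-algebra is a $*$-algebra that is a direct sum $\mathcal{A}=\bigoplus_{g\in G}\mathcal{A}_g$ of vector spaces with $\mathcal{A}_g\cdot\mathcal{A}_h\subseteq\mathcal{A}_{gh}$ and $(\mathcal{A}_g)^*\subseteq\mathcal{A}_{g^{-1}}$ for $g,h\in G$. $\sum\mathcal{A}^2$ denotes the set of all finite sums of elements $a^*a$, $a\in\mathcal{A}$. For a unital $*$-subalgebra $\mathcal{B}$ of a unital $*$-algebra $\mathcal{A}$, a conditional expectation of $\mathcal{A}$ onto $\mathcal{B}$ is a linear map $p:\mathcal{A}\to\mathcal{B}$ such that (i) $p(a^* )=p(a)^*$, $p(b_1ab_2)=b_1p(a)b_2$ for all $a\in\mathcal{A}$, $b_1,b_2\in\mathcal{B}$, and $p(\mathbf{1}_{\mathcal{A}})=\mathbf{1}_{\mathcal{B}}$; (ii) $p(\sum\mathcal{A}^2)\subseteq\sum\mathcal{A}^2\cap\mathcal{B}$. *)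

theory Defs
  imports Complex_Main "HOL-Algebra.Group"
begin

text \<open>
  A *-algebra is carried by a whole type. The sort \<open>{ring, monoid_mult}\<close> is used for
  unital algebras instead of \<open>ring_1\<close>, because the latter excludes the zero algebra.
\<close>

locale star_algebra = vector_space scale
  for scale :: "complex \<Rightarrow> 'a::ring \<Rightarrow> 'a" +
  fixes star :: "'a \<Rightarrow> 'a"
  assumes scale_mult_left: "scale z x * y = scale z (x * y)"
    and scale_mult_right: "x * scale z y = scale z (x * y)"
    and star_add: "star (x + y) = star x + star y"
    and star_scale: "star (scale z x) = scale (cnj z) (star x)"
    and star_mult: "star (x * y) = star y * star x"
    and star_star: "star (star x) = x"

text \<open>
  Families indexed by \<open>I\<close> are functions that vanish outside \<open>I\<close>, so that uniqueness of a
  decomposition can be expressed by \<open>\<exists>!\<close>.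
\<close>

definition decomposition :: "'g set \<Rightarrow> ('g \<Rightarrow> 'a::ab_group_add set) \<Rightarrow> 'a \<Rightarrow> ('g \<Rightarrow> 'a) \<Rightarrow> bool"
  where "decomposition I V a c \<longleftrightarrow>
    (\<forall>i\<in>I. c i \<in> V i) \<and> (\<forall>i. i \<notin> I \<longrightarrow> c i = 0) \<and>
    finite {i. c i \<noteq> 0} \<and> a = (\<Sum>i | c i \<noteq> 0. c i)"

locale graded_star_algebra =
  group G + star_algebra scale star
  for G :: "('g, 'm) monoid_scheme" (structure)
    and scale :: "complex \<Rightarrow> 'a::ring \<Rightarrow> 'a"
    and star :: "'a \<Rightarrow> 'a" +
  fixes V :: "'g \<Rightarrow> 'a set"
  assumes subspace_component: "g \<in> carrier G \<Longrightarrow> subspace (V g)"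
    and direct_sum: "\<exists>!c. decomposition (carrier G) V a c"
    and mult_component:
      "\<lbrakk>g \<in> carrier G; h \<in> carrier G; x \<in> V g; y \<in> V h\<rbrakk> \<Longrightarrow> x * y \<in> V (g \<otimes> h)"
    and star_component: "\<lbrakk>g \<in> carrier G; x \<in> V g\<rbrakk> \<Longrightarrow> star x \<in> V (inv g)"

definition component :: "('g, 'm) monoid_scheme \<Rightarrow> ('g \<Rightarrow> 'a::ab_group_add set) \<Rightarrow> 'a \<Rightarrow> 'g \<Rightarrow> 'a"
  where "component G V a = (THE c. decomposition (carrier G) V a c)"

definition graded_part :: "('g \<Rightarrow> 'a::ab_group_add set) \<Rightarrow> 'g set \<Rightarrow> 'a set"
  where "graded_part V H = {a. \<exists>c. decomposition H V a c}"

definition graded_projection ::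
    "('g, 'm) monoid_scheme \<Rightarrow> ('g \<Rightarrow> 'a::ab_group_add set) \<Rightarrow> 'g set \<Rightarrow> 'a \<Rightarrow> 'a"
  where "graded_projection G V H a =
    (\<Sum>g | g \<in> H \<and> component G V a g \<noteq> 0. component G V a g)"

definition sums_of_squares :: "('a::ring \<Rightarrow> 'a) \<Rightarrow> 'a set"
  where "sums_of_squares star = {sum_list (map (\<lambda>a. star a * a) xs) | xs. True}"

text \<open>The unit of a unital *-subalgebra is that of the ambient algebra.\<close>

definition unital_star_subalgebra ::
    "(complex \<Rightarrow> 'a \<Rightarrow> 'a) \<Rightarrow> ('a \<Rightarrow> 'a) \<Rightarrow> 'a::{ring, monoid_mult} set \<Rightarrow> bool"
  where "unital_star_subalgebra scale star B \<longleftrightarrow>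
    module.subspace scale B \<and> 1 \<in> B \<and>
    (\<forall>x\<in>B. \<forall>y\<in>B. x * y \<in> B) \<and> (\<forall>x\<in>B. star x \<in> B)"

definition conditional_expectation ::
    "(complex \<Rightarrow> 'a \<Rightarrow> 'a) \<Rightarrow> ('a \<Rightarrow> 'a) \<Rightarrow> 'a::{ring, monoid_mult} set \<Rightarrow> ('a \<Rightarrow> 'a) \<Rightarrow> bool"
  where "conditional_expectation scale star B p \<longleftrightarrow>
    unital_star_subalgebra scale star B \<and>
    Vector_Spaces.linear scale scale p \<and> range p \<subseteq> B \<and>
    (\<forall>a. p (star a) = star (p a)) \<and>
    (\<forall>a. \<forall>b1\<in>B. \<forall>b2\<in>B. p (b1 * a * b2) = b1 * p a * b2) \<and>
    p 1 = 1 \<and>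
    p ` sums_of_squares star \<subseteq> sums_of_squares star \<inter> B"

end

theory Submission imports Defs "HOL-Algebra.Coset" begin

text \<open>
  Write \<open>p\<^sub>K a\<close> for the part of \<open>a\<close> with degrees in \<open>K\<close>. Since every element is a finite sum of
  homogeneous ones, the algebraic identities for \<open>p\<^sub>H\<close> (linearity, compatibility with the
  involution, the bimodule property) only have to be checked on homogeneous elements, where they
  say that \<open>H\<close> is closed under inversion and that, for \<open>h \<in> H\<close>, the degrees \<open>hg\<close> and \<open>gh\<close> lie in
  \<open>H\<close> exactly if \<open>g\<close> does. That \<open>p\<^sub>H\<close> fixes the unit holds because the unit has degree \<open>\<one>\<close>.

  The point of substance is positivity. Sorting the homogeneous components of \<open>a\<close> by the left
  cosets of \<open>H\<close> gives \<open>a = (\<Sum>C. a\<^sub>C)\<close>, a finite sum. For \<open>g \<in> C\<close> and \<open>h \<in> D\<close> the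
  product \<open>a\<^sub>g\<^sup>* a\<^sub>h\<close> has degree \<open>g\<^sup>-\<^sup>1 h\<close>, which lies in \<open>H\<close> exactly if \<open>C = D\<close>. So the
  cross terms of \<open>a\<^sup>* a\<close> are killed by \<open>p\<^sub>H\<close> and the diagonal ones are kept:
  \<open>p\<^sub>H (a\<^sup>* a) = (\<Sum>C. a\<^sub>C\<^sup>* a\<^sub>C)\<close>, again a sum of squares (\<open>projection_square\<close>).
\<close>

lemma (in group) inv_mult_mem_iff_l_coset_eq:
  assumes "subgroup H G" "g \<in> carrier G" "h \<in> carrier G"
  shows "inv g \<otimes> h \<in> H \<longleftrightarrow> g <# H = h <# H"
proof
  assume "inv g \<otimes> h \<in> H"
  moreover have "h = g \<otimes> (inv g \<otimes> h)"
    using assms by (simp add: m_assoc[symmetric])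
  ultimately have "h \<in> g <# H"
    unfolding l_coset_def by blast
  then show "g <# H = h <# H"
    using assms l_repr_independence by blast
next
  assume "g <# H = h <# H"
  moreover have "h \<in> h <# H"
    using assms subgroup.one_closed[OF assms(1)] unfolding l_coset_def by force
  ultimately obtain k where k: "k \<in> H" "h = g \<otimes> k"
    unfolding l_coset_def by blast
  then have "inv g \<otimes> h = k"
    using assms subgroup.mem_carrier[OF assms(1)] by (simp add: m_assoc[symmetric])
  with k show "inv g \<otimes> h \<in> H"
    by simp
qed

lemma sums_of_squares_add:
  assumes "a \<in> sums_of_squares star" "b \<in> sums_of_squares star"
  shows "a + b \<in> sums_of_squares star"
proof -
  obtain xs ys where "a = (\<Sum>x\<leftarrow>xs. star x * x)" "b = (\<Sum>x\<leftarrow>ys. star x * x)"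
    using assms unfolding sums_of_squares_def by auto
  then have "a + b = (\<Sum>x\<leftarrow>xs @ ys. star x * x)"
    by simp
  then show ?thesis
    unfolding sums_of_squares_def by blast
qed

lemma zero_in_sums_of_squares: "0 \<in> sums_of_squares star"
  unfolding sums_of_squares_def by (auto intro!: exI[of _ "[]"])

lemma square_in_sums_of_squares: "star a * a \<in> sums_of_squares star"
  unfolding sums_of_squares_def by (auto intro!: exI[of _ "[a]"])

lemma sum_in_sums_of_squares:
  "(\<Sum>i\<in>I. star (f i) * f i) \<in> sums_of_squares star"
  by (induction I rule: infinite_finite_induct)
     (auto intro: sums_of_squares_add zero_in_sums_of_squares square_in_sums_of_squares)

context star_algebra
begin

lemma star_zero: "star 0 = 0"
  using star_add[of 0 0] by simp

lemma star_sum: "star (\<Sum>i\<in>I. f i) = (\<Sum>i\<in>I. star (f i))"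
  by (induction I rule: infinite_finite_induct) (simp_all add: star_zero star_add)

end

context graded_star_algebra
begin

section \<open>Homogeneous components\<close>

lemma decomposition_component: "decomposition (carrier G) V a (component G V a)"
  unfolding component_def using direct_sum by (rule theI')

lemma component_eqI:
  assumes "decomposition (carrier G) V a c"
  shows "component G V a = c"
  using assms decomposition_component direct_sum by blast

lemma component_mem: "g \<in> carrier G \<Longrightarrow> component G V a g \<in> V g"
  using decomposition_component unfolding decomposition_def by blast

lemma component_outside: "g \<notin> carrier G \<Longrightarrow> component G V a g = 0"
  using decomposition_component unfolding decomposition_def by blast

lemma finite_support: "finite {g. component G V a g \<noteq> 0}"
  using decomposition_component unfolding decomposition_def by blast

lemma sum_component: "(\<Sum>g | component G V a g \<noteq> 0. component G V a g) = a"
  using decomposition_component unfolding decomposition_def by metis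

lemma component_add: "component G V (a + b) g = component G V a g + component G V b g"
proof -
  let ?c = "component G V a" and ?d = "component G V b"
  let ?S = "{g. ?c g \<noteq> 0} \<union> {g. ?d g \<noteq> 0}"
  have fin: "finite ?S"
    using finite_support by simp
  have supp: "{g. ?c g + ?d g \<noteq> 0} \<subseteq> ?S"
    by auto
  have "sum ?c {g. ?c g \<noteq> 0} = sum ?c ?S" "sum ?d {g. ?d g \<noteq> 0} = sum ?d ?S"
    using fin by (auto intro: sum.mono_neutral_left)
  then have "a + b = sum ?c ?S + sum ?d ?S"
    by (simp only: sum_component)
  also have "\<dots> = (\<Sum>g\<in>?S. ?c g + ?d g)"
    by (rule sum.distrib[symmetric])
  also have "\<dots> = (\<Sum>g | ?c g + ?d g \<noteq> 0. ?c g + ?d g)"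
    using fin supp by (intro sum.mono_neutral_right) auto
  finally have "decomposition (carrier G) V (a + b) (\<lambda>g. ?c g + ?d g)"
    unfolding decomposition_def
    using finite_subset[OF supp fin]
    by (auto simp: component_mem component_outside subspace_component intro: subspace_add)
  then show ?thesis
    by (simp add: component_eqI)
qed

lemma component_homogeneous:
  assumes "g \<in> carrier G" "x \<in> V g"
  shows "component G V x = (\<lambda>k. if k = g then x else 0)"
proof (rule component_eqI)
  have "{k. (if k = g then x else 0) \<noteq> 0} = (if x = 0 then {} else {g})"
    by auto
  then show "decomposition (carrier G) V x (\<lambda>k. if k = g then x else 0)"
    using assms subspace_component
    unfolding decomposition_def by (auto intro: subspace_0)
qed

text \<open>The induction by which every additive identity is reduced to homogeneous elements.\<close>

lemma homogeneous_induct [case_names homogeneous add]: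
  assumes homogeneous: "\<And>g x. g \<in> carrier G \<Longrightarrow> x \<in> V g \<Longrightarrow> P x"
    and add: "\<And>x y. P x \<Longrightarrow> P y \<Longrightarrow> P (x + y)"
  shows "P a"
proof -
  have "P 0"
    using homogeneous[OF one_closed] subspace_0[OF subspace_component[OF one_closed]] by blast
  have "P (component G V a g)" for g
    using homogeneous component_mem component_outside \<open>P 0\<close> by metis
  then have "P (\<Sum>g\<in>S. component G V a g)" for S
    by (induction S rule: infinite_finite_induct) (auto intro: add \<open>P 0\<close>)
  then show ?thesis
    using sum_component by metis
qed

section \<open>Projections onto arbitrary sets of degrees\<close>

abbreviation proj :: "'g set \<Rightarrow> 'a \<Rightarrow> 'a"
  where "proj K \<equiv> graded_projection G V K"

lemma projection_eq_sum:
  assumes "finite S" "{g. component G V a g \<noteq> 0} \<subseteq> S"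
  shows "proj K a = (\<Sum>g\<in>S \<inter> K. component G V a g)"
  unfolding graded_projection_def
  using assms by (intro sum.mono_neutral_left) auto

lemma projection_add: "proj K (a + b) = proj K a + proj K b"
proof -
  let ?S = "{g. component G V a g \<noteq> 0} \<union> {g. component G V b g \<noteq> 0}"
  have "finite ?S"
    using finite_support by simp
  moreover have "{g. component G V (a + b) g \<noteq> 0} \<subseteq> ?S"
    by (auto simp: component_add)
  ultimately show ?thesis
    by (simp add: projection_eq_sum[of ?S] component_add sum.distrib)
qed

lemma projection_homogeneous:
  assumes "g \<in> carrier G" "x \<in> V g"
  shows "proj K x = (if g \<in> K then x else 0)"
proof -
  have "proj K x = (\<Sum>k\<in>{g} \<inter> K. component G V x k)"
    using assms by (intro projection_eq_sum) (auto simp: component_homogeneous)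
  then show ?thesis
    using assms by (auto simp: component_homogeneous Int_insert_left)
qed

lemma projection_zero: "proj K 0 = 0"
  using projection_add[of K 0 0] by simp

lemma projection_sum: "proj K (\<Sum>i\<in>I. f i) = (\<Sum>i\<in>I. proj K (f i))"
  by (induction I rule: infinite_finite_induct) (simp_all add: projection_zero projection_add)

lemma projection_scale: "proj K (scale z a) = scale z (proj K a)"
  by (induction a rule: homogeneous_induct)
     (simp_all add: projection_homogeneous projection_add scale_right_distrib
        subspace_scale subspace_component)

lemma linear_projection: "Vector_Spaces.linear scale scale (proj K)"
  by unfold_locales (simp_all add: projection_add projection_scale)

lemma projection_in_graded_part:
  assumes "K \<subseteq> carrier G"
  shows "proj K a \<in> graded_part V K"
proof -
  let ?c = "\<lambda>g. if g \<in> K then component G V a g else 0"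
  have "{g. ?c g \<noteq> 0} = {g. g \<in> K \<and> component G V a g \<noteq> 0}"
    by auto
  then have "decomposition K V (proj K a) ?c"
    using assms finite_support[of a] component_mem
    unfolding decomposition_def graded_projection_def by (auto intro!: sum.cong)
  then show ?thesis
    unfolding graded_part_def by blast
qed

lemma projection_eq_self:
  assumes "K \<subseteq> carrier G" "a \<in> graded_part V K"
  shows "proj K a = a"
proof -
  obtain c where c: "decomposition K V a c"
    using assms unfolding graded_part_def by blast
  then have "decomposition (carrier G) V a c"
    using assms subspace_0[OF subspace_component]
    unfolding decomposition_def by (metis subsetD)
  then have "component G V a = c"
    by (rule component_eqI)
  moreover have "{g. g \<in> K \<and> c g \<noteq> 0} = {g. c g \<noteq> 0}"
    using c unfolding decomposition_def by auto
  ultimately show ?thesis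
    using c unfolding graded_projection_def decomposition_def by simp
qed

section \<open>Projections onto subgroups\<close>

context
  fixes H
  assumes subgroup: "subgroup H G"
begin

text \<open>Membership in \<open>\<A>\<^sub>H\<close> as an equation turns closure properties of \<open>\<A>\<^sub>H\<close> into
  identities for the projection.\<close>

lemma mem_graded_part_iff: "a \<in> graded_part V H \<longleftrightarrow> proj H a = a"
  using projection_eq_self projection_in_graded_part subgroup.subset[OF subgroup] by metis

lemma projection_star: "proj H (star a) = star (proj H a)"
proof (induction a rule: homogeneous_induct)
  case (homogeneous g x)
  moreover have "inv g \<in> H \<longleftrightarrow> g \<in> H"
    using homogeneous subgroup subgroup.m_inv_closed[OF subgroup] by (metis inv_inv)
  ultimately show ?case
    by (simp add: projection_homogeneous[of g] projection_homogeneous[of "inv g"]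
          star_component star_zero)
qed (simp add: projection_add star_add)

lemma projection_mult_left: "proj H (proj H b * a) = proj H b * proj H a"
proof (induction b rule: homogeneous_induct)
  case (homogeneous h y)
  show ?case
  proof (induction a rule: homogeneous_induct)
    case (homogeneous g x)
    have "inv h \<otimes> (h \<otimes> g) = g"
      using homogeneous \<open>h \<in> carrier G\<close> by (simp add: m_assoc[symmetric])
    then have "h \<otimes> g \<in> H \<longleftrightarrow> g \<in> H" if "h \<in> H"
      using subgroup.m_closed[OF subgroup that, of g]
        subgroup.m_closed[OF subgroup subgroup.m_inv_closed[OF subgroup that], of "h \<otimes> g"]
      by auto
    then show ?case
      using homogeneous \<open>h \<in> carrier G\<close> \<open>y \<in> V h\<close> mult_component
      by (simp add: projection_homogeneous[of h] projection_homogeneous[of g]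
            projection_homogeneous[of "h \<otimes> g"] projection_zero)
  qed (simp add: projection_add distrib_left)
qed (simp add: projection_add distrib_right)

lemma projection_mult_right: "proj H (a * proj H b) = proj H a * proj H b"
proof -
  have "star (proj H (a * proj H b)) = proj H (proj H (star b) * star a)"
    by (simp add: projection_star[symmetric] star_mult)
  also have "\<dots> = star (proj H a * proj H b)"
    unfolding projection_mult_left by (simp add: projection_star star_mult)
  finally show ?thesis
    using star_star by metis
qed

lemma projection_bimodule:
  assumes "b \<in> graded_part V H" "b' \<in> graded_part V H"
  shows "proj H (b * a * b') = b * proj H a * b'"
  using assms projection_mult_left[of b a] projection_mult_right[of "b * a" b']
  by (simp add: mem_graded_part_iff)

section \<open>Positivity\<close>

definition coset_part :: "'g set \<Rightarrow> 'a \<Rightarrow> 'a"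
  where "coset_part C = proj {g \<in> carrier G. g <# H = C}"

lemma sum_coset_parts: "\<exists>F. finite F \<and> a = (\<Sum>C\<in>F. coset_part C a)"
proof -
  let ?S = "{g. component G V a g \<noteq> 0}"
  let ?F = "(\<lambda>g. g <# H) ` ?S"
  have "a = (\<Sum>g\<in>?S. component G V a g)"
    by (simp add: sum_component)
  also have "\<dots> = (\<Sum>C\<in>?F. \<Sum>g | g \<in> ?S \<and> g <# H = C. component G V a g)"
    by (rule sum.image_gen) (rule finite_support)
  also have "\<dots> = (\<Sum>C\<in>?F. coset_part C a)"
    unfolding coset_part_def graded_projection_def
    using component_outside by (intro sum.cong) auto
  finally show ?thesis
    using finite_support by blast
qed

text \<open>Elements supported on left cosets are orthogonal for the \<open>\<A>\<^sub>H\<close>-valued form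
  \<open>p\<^sub>H (a\<^sup>* b)\<close>, because \<open>g\<^sup>-\<^sup>1 h \<in> H\<close> means that \<open>g\<close> and \<open>h\<close> are in the same left coset.\<close>

lemma projection_star_coset_part_mult:
  "proj H (star (coset_part C a) * coset_part D b) =
    (if C = D then star (coset_part C a) * coset_part D b else 0)"
proof (induction a rule: homogeneous_induct)
  case (homogeneous g x)
  show ?case
  proof (induction b rule: homogeneous_induct)
    case (homogeneous h y)
    have "star x * y \<in> V (inv g \<otimes> h)"
      using homogeneous \<open>g \<in> carrier G\<close> \<open>x \<in> V g\<close> by (simp add: mult_component star_component)
    then have "proj H (star x * y) = (if g <# H = h <# H then star x * y else 0)"
      using homogeneous \<open>g \<in> carrier G\<close> inv_mult_mem_iff_l_coset_eq[OF subgroup]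
      by (simp add: projection_homogeneous[of "inv g \<otimes> h"])
    then show ?case
      using homogeneous \<open>g \<in> carrier G\<close> \<open>x \<in> V g\<close> unfolding coset_part_def
      by (auto simp: projection_homogeneous[of g] projection_homogeneous[of h]
            star_zero projection_zero)
  qed (auto simp: coset_part_def projection_add distrib_left)
qed (auto simp: coset_part_def projection_add star_add distrib_right)

lemma projection_square: "proj H (star a * a) \<in> sums_of_squares star"
proof -
  obtain F where F: "finite F" "a = (\<Sum>C\<in>F. coset_part C a)"
    using sum_coset_parts by blast
  have "star a * a = star (\<Sum>C\<in>F. coset_part C a) * (\<Sum>D\<in>F. coset_part D a)"
    using F(2) by simp
  then have "proj H (star a * a) =
      (\<Sum>C\<in>F. \<Sum>D\<in>F. proj H (star (coset_part C a) * coset_part D a))"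
    by (simp add: star_sum sum_product projection_sum)
  also have "\<dots> = (\<Sum>C\<in>F. star (coset_part C a) * coset_part C a)"
    using F(1) by (simp add: projection_star_coset_part_mult)
  finally show ?thesis
    by (simp add: sum_in_sums_of_squares[of star])
qed

lemma projection_sums_of_squares:
  assumes "a \<in> sums_of_squares star"
  shows "proj H a \<in> sums_of_squares star"
proof -
  have "proj H (\<Sum>x\<leftarrow>xs. star x * x) \<in> sums_of_squares star" for xs
    by (induction xs)
       (auto simp: projection_zero projection_add zero_in_sums_of_squares
          intro: sums_of_squares_add projection_square)
  then show ?thesis
    using assms unfolding sums_of_squares_def by blast
qed

end

end

section \<open>The unit and the conditional expectation\<close>

text \<open>Comparing the components of degree \<open>g\<close> in \<open>x = x 1\<close> for \<open>x\<close> of degree \<open>g\<close> shows that the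
  component of \<open>1\<close> of degree \<open>\<one>\<close> is itself a right unit, hence equal to \<open>1\<close>.\<close>

lemma one_in_unit_component:
  fixes G (structure) and V :: "'g \<Rightarrow> 'a::{ring, monoid_mult} set"
  assumes "graded_star_algebra G scale star V"
  shows "1 \<in> V \<one>"
proof -
  interpret graded_star_algebra G scale star V
    by fact
  define e where "e = component G V 1 \<one>"
  have e: "proj {\<one>} b = component G V b \<one>" for b
    unfolding graded_projection_def by (auto simp: Collect_conv_if)
  have component_mult: "proj {g} (x * b) = x * proj {\<one>} b" if "g \<in> carrier G" "x \<in> V g" for g x b
  proof (induction b rule: homogeneous_induct)
    case (homogeneous h y)
    have "g \<otimes> h = g \<longleftrightarrow> h = \<one>"
      using homogeneous that by simp
    then show ?case
      using homogeneous that mult_component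
      by (simp add: projection_homogeneous[of h] projection_homogeneous[of "g \<otimes> h"])
  qed (simp add: projection_add distrib_left)
  have "a * e = a" for a
  proof (induction a rule: homogeneous_induct)
    case (homogeneous g x)
    then show ?case
      using component_mult[of g x 1] by (simp add: e_def e projection_homogeneous[of g x])
  qed (simp add: distrib_right)
  then have "e = 1"
    by (metis mult_1)
  then show ?thesis
    using component_mem[of \<one> 1] by (simp add: e_def)
qed

theorem proposition6:
  fixes G :: "('g, 'm) monoid_scheme"
    and scale :: "complex \<Rightarrow> 'a::{ring, monoid_mult} \<Rightarrow> 'a"
    and star :: "'a \<Rightarrow> 'a"
    and V :: "'g \<Rightarrow> 'a set"
    and H :: "'g set"
  assumes "graded_star_algebra G scale star V"
    and "subgroup H G"
  shows "conditional_expectation scale star (graded_part V H) (graded_projection G V H)"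
proof -
  interpret graded_star_algebra G scale star V
    by fact
  note H = \<open>subgroup H G\<close>
  note fixed = mem_graded_part_iff[OF H]
  have one: "proj H 1 = 1"
    using one_in_unit_component[OF assms(1)] subgroup.one_closed[OF H]
    by (simp add: projection_homogeneous[OF one_closed])
  have "x * y \<in> graded_part V H" if "x \<in> graded_part V H" "y \<in> graded_part V H" for x y
    using that projection_mult_left[OF H, of x y] by (simp add: fixed)
  then have "unital_star_subalgebra scale star (graded_part V H)"
    unfolding unital_star_subalgebra_def subspace_def
    by (auto simp: fixed one projection_zero projection_add projection_scale projection_star[OF H])
  then show ?thesis
    unfolding conditional_expectation_def
    using linear_projection projection_in_graded_part[OF subgroup.subset[OF H]]
    by (auto simp: projection_star[OF H] projection_bimodule[OF H] one
          projection_sums_of_squares[OF H])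
qed

end
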